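(* The function $x \mapsto \lambda_{\min}(x)$ is concave on $\mathcal{E}$ and Lipschitz continuous in the sense that $$|\lambda_{\min}(x) - \lambda_{\min}(y)| \leq \|x-y\|_{\infty} \quad \text{for all } x,y \in \mathcal{E}.$$
   Context: $\mathcal{E}$ is a finite-dimensional real Euclidean space, and $\mathcal{K} \subset \mathcal{E}$ is a proper (meaning $\mathcal{K} \neq \mathcal{E}$; not necessarily pointed) closed convex cone with nonempty interior $\mathrm{int}(\mathcal{K})$. A vector $e \in \mathrm{int}(\mathcal{K})$ (the "distinguished direction") is fixed. For $x \in \mathcal{E}$, define $$\lambda_{\min}(x) := \inf\{\lambda \in \mathbb{R} : x - \lambda e \notin \mathcal{K}\},$$ i.e. the unique scalar $\lambda$ for which $x - \lambda e$ lies in the boundary of $\mathcal{K}$. Let $\bar{\mathcal{B}} := \{v \in \mathcal{E} : e+v \in \mathcal{K} \text{ and } e-v \in \mathcal{K}\}$, a closed, centrally symmetric convex set with nonempty interior, and define the seminorm $$\|u\|_{\infty} := \inf\{t \geq 0 : u = tv \text{ for some } v \in \bar{\mathcal{B}}\}, \quad u \in \mathcal{E}.$$ *)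

theory Defs
  imports "HOL-Analysis.Analysis"
begin

text \<open>Throughout, \<open>K\<close> is the closed convex cone and \<open>e\<close> the distinguished direction.
  The infima below are taken in \<^typ>\<open>real\<close>; when \<open>K \<noteq> UNIV\<close> and \<open>e \<in> interior K\<close>
  both sets are nonempty and bounded below, so no default value of \<^const>\<open>Inf\<close> is involved.\<close>

definition lambda_min :: "'a::euclidean_space set \<Rightarrow> 'a \<Rightarrow> 'a \<Rightarrow> real" where
  "lambda_min K e x = Inf {l :: real. x - l *\<^sub>R e \<notin> K}"

definition unit_set :: "'a::euclidean_space set \<Rightarrow> 'a \<Rightarrow> 'a set" where
  "unit_set K e = {v. e + v \<in> K \<and> e - v \<in> K}"

definition norm_inf :: "'a::euclidean_space set \<Rightarrow> 'a \<Rightarrow> 'a \<Rightarrow> real" where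
  "norm_inf K e u = Inf {t :: real. t \<ge> 0 \<and> (\<exists>v \<in> unit_set K e. u = t *\<^sub>R v)}"

end

theory Submission
  imports Defs
begin

text \<open>Everything rests on one equivalence: \<open>l \<le> lambda_min K e x\<close> holds exactly when
  \<open>x - l *\<^sub>R e \<in> K\<close> (lemma \<open>le_lambda_min_iff\<close>). It turns an inequality for \<open>lambda_min\<close> into
  a membership in \<open>K\<close>, where closure of \<open>K\<close> under addition and nonnegative scaling applies:
  a combination \<open>u *\<^sub>R (x - l *\<^sub>R e) + v *\<^sub>R (y - m *\<^sub>R e)\<close> with nonnegative \<open>u\<close>, \<open>v\<close> stays in
  \<open>K\<close>, which is concavity; and if \<open>x - y = t *\<^sub>R v\<close> with \<open>e + v \<in> K\<close>, then adding
  \<open>t *\<^sub>R (e + v) = (x - y) + t *\<^sub>R e\<close> to \<open>y - m *\<^sub>R e\<close> gives \<open>x - (m - t) *\<^sub>R e \<in> K\<close>, which is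
  the Lipschitz bound.

  The equivalence depends on two consequences of \<open>e\<close> being an interior point: a large multiple
  of \<open>e\<close> absorbs any vector into \<open>K\<close> (lemma \<open>interior_absorbs\<close>), and
  \<open>- e \<notin> K\<close> unless \<open>K\<close> is the whole space. Together they make the set whose infimum is
  \<open>lambda_min K e x\<close> nonempty and bounded below.\<close>

lemma cone_scale:
  assumes "cone K" "x \<in> K" "0 \<le> c"
  shows "c *\<^sub>R x \<in> K"
  using assms by (auto simp: cone_def)

lemma convex_cone_add:
  assumes "convex K" "cone K" "x \<in> K" "y \<in> K"
  shows "x + y \<in> K"
  using assms convex_cone by blast

text \<open>Shrinking \<open>x\<close> by the factor \<open>t\<close> moves both \<open>e + x /\<^sub>R t\<close> and \<open>e - x /\<^sub>R t\<close> into a ball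
  around \<open>e\<close> that lies in \<open>K\<close>; scaling back by \<open>t\<close> stays in the cone.\<close>

lemma interior_absorbs:
  fixes K :: "'a::euclidean_space set"
  assumes "cone K" "e \<in> interior K"
  obtains t where "0 < t" "t *\<^sub>R e + x \<in> K" "t *\<^sub>R e - x \<in> K"
proof -
  obtain r where r: "0 < r" "cball e r \<subseteq> K"
    using assms(2) mem_interior_cball by blast
  \<comment> \<open>The summand 1 keeps \<open>t\<close> positive when \<open>x = 0\<close>.\<close>
  define t where "t = (norm x + 1) / r"
  have t: "0 < t"
    using r(1) by (simp add: t_def add_nonneg_pos)
  have "norm (x /\<^sub>R t) = norm x / t"
    using t by (simp add: divide_inverse mult.commute)
  also have "\<dots> \<le> r"
  proof -
    have "r * t = norm x + 1"
      using r(1) by (simp add: t_def)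
    then show ?thesis
      using t by (simp add: pos_divide_le_eq)
  qed
  finally have "e + x /\<^sub>R t \<in> K" "e - x /\<^sub>R t \<in> K"
    using r(2) by (auto simp: subset_iff dist_norm)
  then have "t *\<^sub>R (e + x /\<^sub>R t) \<in> K" "t *\<^sub>R (e - x /\<^sub>R t) \<in> K"
    using assms(1) t by (auto intro!: cone_scale)
  with t that[of t] show thesis
    by (simp add: scaleR_add_right scaleR_diff_right)
qed

lemma neg_interior_notin_proper_cone:
  fixes K :: "'a::euclidean_space set"
  assumes "convex K" "cone K" "K \<noteq> UNIV" "e \<in> interior K"
  shows "- e \<notin> K"
proof
  assume neg: "- e \<in> K"
  have "x \<in> K" for x
  proof -
    obtain t where t: "0 < t" "t *\<^sub>R e + x \<in> K"
      using interior_absorbs[OF assms(2,4)] by metis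
    have "t *\<^sub>R (- e) + (t *\<^sub>R e + x) \<in> K"
      using convex_cone_add[OF assms(1,2) cone_scale[OF assms(2) neg, of t] t(2)] t(1) by simp
    then show ?thesis by simp
  qed
  with assms(3) show False by blast
qed

text \<open>Subtracting less of \<open>e \<in> K\<close> keeps a point in \<open>K\<close>, so the parameters \<open>l\<close> with
  \<open>x - l *\<^sub>R e \<in> K\<close> form a down-set of \<open>\<real>\<close>. It is nonempty since \<open>e\<close> absorbs \<open>x\<close>, and it
  omits some parameter since otherwise absorbing \<open>- x\<close> would put \<open>- e\<close> in \<open>K\<close>. Since \<open>K\<close> is
  closed, the down-set contains its endpoint, the infimum of its complement.\<close>

lemma le_lambda_min_iff:
  fixes K :: "'a::euclidean_space set"
  assumes "closed K" "convex K" "cone K" "K \<noteq> UNIV" "e \<in> interior K"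
  shows "l \<le> lambda_min K e x \<longleftrightarrow> x - l *\<^sub>R e \<in> K"
proof -
  define S where "S = {l :: real. x - l *\<^sub>R e \<notin> K}"
  have "e \<in> K"
    using assms(5) interior_subset by blast
  have down: "x - m *\<^sub>R e \<in> K" if "x - l *\<^sub>R e \<in> K" "m \<le> l" for l m
  proof -
    have "(x - l *\<^sub>R e) + (l - m) *\<^sub>R e \<in> K"
      using that assms \<open>e \<in> K\<close> by (intro convex_cone_add cone_scale) auto
    then show ?thesis by (simp add: algebra_simps)
  qed
  obtain t where t: "t *\<^sub>R e + x \<in> K" "t *\<^sub>R e - x \<in> K"
    using interior_absorbs[OF assms(3,5)] by metis
  have lower: "- t \<le> s" if "s \<in> S" for s
    using that down[of "- t" s] t(1) by (force simp: S_def add.commute)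
  then have bdd: "bdd_below S"
    by (auto simp: bdd_below_def)
  have "t + 1 \<in> S"
  proof (rule ccontr)
    assume "t + 1 \<notin> S"
    then have "(x - (t + 1) *\<^sub>R e) + (t *\<^sub>R e - x) \<in> K"
      using assms t(2) by (intro convex_cone_add) (auto simp: S_def)
    then show False
      using neg_interior_notin_proper_cone[OF assms(2-5)] by (simp add: algebra_simps)
  qed
  then have "S \<noteq> {}" by blast
  have "open S"
  proof -
    have "S = (\<lambda>l. x - l *\<^sub>R e) -` (- K)"
      by (auto simp: S_def)
    then show ?thesis
      using assms(1) by (auto intro!: open_vimage continuous_intros)
  qed
  have "Inf S \<notin> S"
  proof
    assume "Inf S \<in> S"
    then obtain d where d: "0 < d" "ball (Inf S) d \<subseteq> S"
      using \<open>open S\<close> openE by blast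
    then have "Inf S - d / 2 \<in> S"
      by (auto simp: subset_iff dist_real_def)
    then show False
      using cInf_lower[OF _ bdd] d(1) by fastforce
  qed
  have "l \<le> Inf S \<longleftrightarrow> l \<notin> S"
  proof
    assume "l \<le> Inf S"
    then show "l \<notin> S"
      using \<open>Inf S \<notin> S\<close> down[of "Inf S" l] by (simp add: S_def)
  next
    assume "l \<notin> S"
    then have "l \<le> s" if "s \<in> S" for s
      using that down[of l s] by (force simp: S_def)
    then show "l \<le> Inf S"
      using \<open>S \<noteq> {}\<close> by (rule cInf_greatest[rotated])
  qed
  then show ?thesis
    by (simp add: lambda_min_def S_def)
qed

text \<open>This keeps the infimum in \<^const>\<open>norm_inf\<close> away from the unspecified \<open>Inf {}\<close>, so
  that a bound valid for every admissible \<open>t\<close> passes to it.\<close>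

lemma unit_set_absorbs:
  fixes K :: "'a::euclidean_space set"
  assumes "cone K" "e \<in> interior K"
  shows "\<exists>t\<ge>0. \<exists>v\<in>unit_set K e. u = t *\<^sub>R v"
proof -
  obtain t where t: "0 < t" "t *\<^sub>R e + u \<in> K" "t *\<^sub>R e - u \<in> K"
    using interior_absorbs[OF assms] by metis
  have "inverse t *\<^sub>R (t *\<^sub>R e + u) \<in> K" "inverse t *\<^sub>R (t *\<^sub>R e - u) \<in> K"
    using t assms(1) by (auto intro!: cone_scale)
  then have "u /\<^sub>R t \<in> unit_set K e"
    using t(1) by (simp add: unit_set_def scaleR_add_right scaleR_diff_right)
  moreover have "u = t *\<^sub>R (u /\<^sub>R t)"
    using t(1) by simp
  ultimately show ?thesis
    using t(1) less_imp_le by blast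
qed

lemma concave_on_lambda_min:
  fixes K :: "'a::euclidean_space set"
  assumes "closed K" "convex K" "cone K" "K \<noteq> UNIV" "e \<in> interior K"
  shows "concave_on UNIV (lambda_min K e)"
  unfolding concave_on_iff
proof (intro conjI ballI allI impI)
  fix x y :: 'a and u v :: real
  assume uv: "0 \<le> u" "0 \<le> v" "u + v = 1"
  let ?l = "lambda_min K e x" and ?m = "lambda_min K e y"
  have "x - ?l *\<^sub>R e \<in> K" "y - ?m *\<^sub>R e \<in> K"
    using le_lambda_min_iff[OF assms] by blast+
  then have "u *\<^sub>R (x - ?l *\<^sub>R e) + v *\<^sub>R (y - ?m *\<^sub>R e) \<in> K"
    using uv assms by (intro convex_cone_add cone_scale)
  then have "(u *\<^sub>R x + v *\<^sub>R y) - (u * ?l + v * ?m) *\<^sub>R e \<in> K"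
    by (simp add: algebra_simps)
  then show "u * ?l + v * ?m \<le> lambda_min K e (u *\<^sub>R x + v *\<^sub>R y)"
    using le_lambda_min_iff[OF assms] by blast
qed simp

text \<open>The one-sided estimate behind the Lipschitz bound: moving from \<open>y\<close> to \<open>x\<close> costs at most
  \<open>t\<close> when \<open>t *\<^sub>R e\<close> absorbs the displacement \<open>x - y\<close>.\<close>

lemma lambda_min_diff_le:
  fixes K :: "'a::euclidean_space set"
  assumes "closed K" "convex K" "cone K" "K \<noteq> UNIV" "e \<in> interior K"
    and "t *\<^sub>R e + (x - y) \<in> K"
  shows "lambda_min K e y - lambda_min K e x \<le> t"
proof -
  let ?m = "lambda_min K e y"
  have "y - ?m *\<^sub>R e \<in> K"
    using le_lambda_min_iff[OF assms(1-5)] by blast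
  then have "(y - ?m *\<^sub>R e) + (t *\<^sub>R e + (x - y)) \<in> K"
    by (rule convex_cone_add[OF assms(2,3) _ assms(6)])
  then have "x - (?m - t) *\<^sub>R e \<in> K"
    by (simp add: algebra_simps)
  then have "?m - t \<le> lambda_min K e x"
    using le_lambda_min_iff[OF assms(1-5)] by blast
  then show ?thesis by simp
qed

lemma lambda_min_Lipschitz:
  fixes K :: "'a::euclidean_space set"
  assumes "closed K" "convex K" "cone K" "K \<noteq> UNIV" "e \<in> interior K"
  shows "\<bar>lambda_min K e x - lambda_min K e y\<bar> \<le> norm_inf K e (x - y)"
  unfolding norm_inf_def
proof (rule cInf_greatest)
  show "{t. 0 \<le> t \<and> (\<exists>v\<in>unit_set K e. x - y = t *\<^sub>R v)} \<noteq> {}"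
    using unit_set_absorbs[OF assms(3,5)] by blast
next
  fix t
  assume "t \<in> {t. 0 \<le> t \<and> (\<exists>v\<in>unit_set K e. x - y = t *\<^sub>R v)}"
  then obtain v where v: "0 \<le> t" "e + v \<in> K" "e - v \<in> K" "x - y = t *\<^sub>R v"
    by (auto simp: unit_set_def)
  have yx: "y - x = - (t *\<^sub>R v)"
    using v(4) by (metis minus_diff_eq)
  have "t *\<^sub>R (e + v) \<in> K" "t *\<^sub>R (e - v) \<in> K"
    using v(1-3) assms(3) by (auto intro!: cone_scale)
  then have "t *\<^sub>R e + (x - y) \<in> K" "t *\<^sub>R e + (y - x) \<in> K"
    by (simp_all add: v(4) yx scaleR_add_right scaleR_diff_right)
  then show "\<bar>lambda_min K e x - lambda_min K e y\<bar> \<le> t"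
    using lambda_min_diff_le[OF assms] by (metis abs_le_iff minus_diff_eq)
qed

theorem proposition2p1:
  fixes K :: "'a::euclidean_space set" and e :: 'a
  assumes "closed K" and "convex K" and "cone K"
    and "K \<noteq> UNIV"
    and "interior K \<noteq> {}"
    and "e \<in> interior K"
  shows "concave_on UNIV (lambda_min K e) \<and>
         (\<forall>x y. \<bar>lambda_min K e x - lambda_min K e y\<bar> \<le> norm_inf K e (x - y))"
  using concave_on_lambda_min[OF assms(1-4,6)] lambda_min_Lipschitz[OF assms(1-4,6)]
  by blast

end
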